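(* Let $\boldsymbol{u}=(u_1,\dots,u_n)$ with $1\le u_1\le\cdots\le u_n$ integers, let $M=\max(\boldsymbol{u})$, and fix a set of cars $I\subseteq[n]$. Let $B=B_1B_2\cdots B_M\in\mathcal{O}_{\boldsymbol{u}}$. Then $B\in\mathcal{O}_{\boldsymbol{u}}(I)$ if and only if the following two conditions hold: (1) if $B_1\neq \mathtt{X}$, then $B_1\subseteq I$; (2) if there exist $b_1\in B_{i-1}\neq\mathtt{X}$ and $b_2\in B_i\neq\mathtt{X}$ (for some $2\le i\le M$) such that $b_1>b_2$, then $b_2\in I$.
   Context: Notation: $[n]=\{1,\dots,n\}$, $\mathbb{N}=\{1,2,\dots\}$. For a weakly increasing vector $\boldsymbol{u}=(u_1,\dots,u_n)$ of positive integers, spot $i\in\mathbb{N}$ on a one-way street has capacity $m_i(\boldsymbol{u})$, the number of times $i$ occurs in $\boldsymbol{u}$. Cars $1,\dots,n$ enter in this order with preferences $\boldsymbol{a}=(a_1,\dots,a_n)\in\mathbb{N}^n$; car $c$ parks in the first spot $j\ge a_c$ in which fewer than $m_j(\boldsymbol{u})$ cars are already parked, and fails to park if there is none. $\boldsymbol{a}$ is a $\boldsymbol{u}$-parking function if all cars park; $\mathrm{PF}(\boldsymbol{u})$ is the set of these. The outcome of $\boldsymbol{a}\in\mathrm{PF}(\boldsymbol{u})$ is $\mathcal{O}_{\boldsymbol{u}}(\boldsymbol{a})=B_1B_2\cdots B_M$ with $M=\max(\boldsymbol{u})$, where $B_i$ is the set of cars parked in spot $i$ if $m_i(\boldsymbol{u})>0$,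 and $B_i=\mathtt{X}$ (a symbol for an unavailable spot) if $m_i(\boldsymbol{u})=0$. $\mathcal{O}_{\boldsymbol{u}}=\{\mathcal{O}_{\boldsymbol{u}}(\boldsymbol{a}):\boldsymbol{a}\in\mathrm{PF}(\boldsymbol{u})\}$. A car is lucky if it parks in its preferred spot; $\mathsf{Lucky}_{\boldsymbol{u}}(\boldsymbol{a})$ is the set of lucky cars of $\boldsymbol{a}$. $\mathcal{O}_{\boldsymbol{u}}(I)=\{\mathcal{O}_{\boldsymbol{u}}(\boldsymbol{a}):\boldsymbol{a}\in\mathrm{PF}(\boldsymbol{u}),\ \mathsf{Lucky}_{\boldsymbol{u}}(\boldsymbol{a})=I\}$. *)

theory Defs
  imports Main
begin

text \<open>
  Cars and spots are numbered from 1. Vectors are lists, so the entry belonging to car \<open>c\<close> is at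
  list position \<open>c - 1\<close>. The capacity of spot \<open>i\<close> is \<open>count_list u i\<close>, which is 0 for all \<open>i\<close>
  beyond the largest entry of \<open>u\<close>.
\<close>

text \<open>\<open>s\<close> lists the results for the cars that have already entered; \<open>None\<close> means failing to park.\<close>

definition park_car :: "nat list \<Rightarrow> nat option list \<Rightarrow> nat \<Rightarrow> nat option" where
  "park_car u s p =
    (if \<exists>j\<ge>p. count_list s (Some j) < count_list u j
     then Some (LEAST j. p \<le> j \<and> count_list s (Some j) < count_list u j)
     else None)"

definition park :: "nat list \<Rightarrow> nat list \<Rightarrow> nat option list" where
  "park u a = fold (\<lambda>p s. s @ [park_car u s p]) a []"

definition parking_functions :: "nat list \<Rightarrow> nat list set" where
  "parking_functions u =
    {a. length a = length u \<and> (\<forall>p\<in>set a. 1 \<le> p) \<and> None \<notin> set (park u a)}"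

definition lucky :: "nat list \<Rightarrow> nat list \<Rightarrow> nat set" where
  "lucky u a = {c \<in> {1..length a}. park u a ! (c - 1) = Some (a ! (c - 1))}"

text \<open>A block is the set of cars in a spot, or \<open>Unavailable\<close> for a spot of capacity 0, where \<open>cars\<close>
  has a mere default value.\<close>

datatype block = Unavailable | Cars (cars: "nat set")
  where "cars Unavailable = {}"

definition outcome :: "nat list \<Rightarrow> nat list \<Rightarrow> block list" where
  "outcome u a =
    map (\<lambda>i. if count_list u i > 0
             then Cars {c \<in> {1..length a}. park u a ! (c - 1) = Some i}
             else Unavailable)
        [1..<Suc (Max (set u))]"

definition nth_block :: "block list \<Rightarrow> nat \<Rightarrow> block" where
  "nth_block B i = B ! (i - 1)"

definition outcomes :: "nat list \<Rightarrow> block list set" where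
  "outcomes u = outcome u ` parking_functions u"

definition lucky_outcomes :: "nat list \<Rightarrow> nat set \<Rightarrow> block list set" where
  "lucky_outcomes u I = {outcome u a | a. a \<in> parking_functions u \<and> lucky u a = I}"

end

theory Submission
  imports Defs "HOL-Library.Multiset"
begin

text \<open>
  Everything rests on one counting fact: as many cars enter as there are parking places, so when all
  of them park, every spot ends up exactly full (\<open>spots_full\<close>). Hence spot \<open>i - 1\<close> is full at
  the moment car \<open>c\<close> enters if and only if none of the cars that end up there enters later than \<open>c\<close>
  (\<open>count_list_take_less_iff\<close>).

  A car parked in spot \<open>i\<close> that preferred an earlier spot has passed spot \<open>i - 1\<close>, so spot
  \<open>i - 1\<close> exists and was full. For a spot that is available this means that all cars in it are
  smaller than the unlucky car, which gives the necessity of both conditions.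

  Conversely, the parking of a given outcome can be reproduced with any set \<open>I\<close> of lucky cars that
  obeys the conditions: cars in \<open>I\<close> prefer the spot they are to take, and every other car prefers
  the spot just before. The latter spot is always full or unavailable when that car enters, so the car
  moves on by exactly one spot (\<open>park_with_lucky_set\<close>).
\<close>

section \<open>Occurrences in a prefix\<close>

lemma count_list_take_less_iff:
  "count_list (take k xs) x < count_list xs x \<longleftrightarrow> (\<exists>m. k \<le> m \<and> m < length xs \<and> xs ! m = x)"
proof -
  have "count_list xs x = count_list (take k xs) x + count_list (drop k xs) x"
    by (metis append_take_drop_id count_list_append)
  then have "count_list (take k xs) x < count_list xs x \<longleftrightarrow> x \<in> set (drop k xs)"
    by (simp add: count_list_0_iff flip: neq0_conv)
  also have "\<dots> \<longleftrightarrow> (\<exists>m. k \<le> m \<and> m < length xs \<and> xs ! m = x)"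
  proof
    assume "x \<in> set (drop k xs)"
    then obtain j where "j < length xs - k" "drop k xs ! j = x"
      by (auto simp: in_set_conv_nth)
    then show "\<exists>m. k \<le> m \<and> m < length xs \<and> xs ! m = x"
      by (intro exI[of _ "k + j"]) auto
  next
    assume "\<exists>m. k \<le> m \<and> m < length xs \<and> xs ! m = x"
    then obtain m where "k \<le> m" "m < length xs" "xs ! m = x"
      by blast
    then show "x \<in> set (drop k xs)"
      by (auto simp: in_set_conv_nth intro!: exI[of _ "m - k"])
  qed
  finally show ?thesis .
qed

section \<open>The parking process\<close>

lemma park_car_eq_Some_iff:
  "park_car u s p = Some j \<longleftrightarrow>
    p \<le> j \<and> count_list s (Some j) < count_list u j \<and>
    (\<forall>i. p \<le> i \<and> i < j \<longrightarrow> count_list u i \<le> count_list s (Some i))" (is "?L \<longleftrightarrow> ?R")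
proof
  let ?P = "\<lambda>j. p \<le> j \<and> count_list s (Some j) < count_list u j"
  assume ?L
  then have ex: "\<exists>j. ?P j" and j: "j = (LEAST j. ?P j)"
    by (auto simp: park_car_def split: if_splits)
  show ?R
    using LeastI_ex[OF ex] not_less_Least[of _ ?P] unfolding j[symmetric]
    by (meson not_le)
next
  let ?P = "\<lambda>j. p \<le> j \<and> count_list s (Some j) < count_list u j"
  assume R: ?R
  then have "(LEAST j. ?P j) = j"
    by (intro Least_equality) (auto simp: not_le[symmetric])
  with R show ?L
    by (auto simp: park_car_def)
qed

lemma park_Nil [simp]: "park u [] = []"
  by (simp add: park_def)

lemma park_snoc: "park u (a @ [p]) = park u a @ [park_car u (park u a) p]"
  by (simp add: park_def)

lemma length_park [simp]: "length (park u a) = length a"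
  by (induction a rule: rev_induct) (simp_all add: park_snoc)

lemma park_nth:
  "k < length a \<Longrightarrow> park u a ! k = park_car u (take k (park u a)) (a ! k)"
proof (induction a rule: rev_induct)
  case (snoc p a)
  then show ?case
    by (cases "k = length a") (auto simp: park_snoc nth_append)
qed simp

text \<open>The recurrence of \<open>park_nth\<close> determines the result, so a parking that is already
  known can be checked car by car.\<close>

lemma park_eqI:
  assumes "length s = length a"
    and "\<And>k. k < length a \<Longrightarrow> s ! k = park_car u (take k s) (a ! k)"
  shows "park u a = s"
  using assms
proof (induction a arbitrary: s rule: rev_induct)
  case (snoc p a)
  from snoc.prems(1) obtain s' y where s: "s = s' @ [y]" "length s' = length a"
    by (cases s rule: rev_cases) auto
  have "park u a = s'"
  proof (rule snoc.IH)
    fix k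
    assume "k < length a"
    then show "s' ! k = park_car u (take k s') (a ! k)"
      using snoc.prems(2)[of k] s by (simp add: nth_append)
  qed (use s in simp)
  moreover have "y = park_car u s' p"
    using snoc.prems(2)[of "length a"] s by (simp add: nth_append)
  ultimately show ?case
    using s by (simp add: park_snoc)
qed simp

lemma count_park_le_capacity: "count_list (park u a) (Some j) \<le> count_list u j"
proof (induction a rule: rev_induct)
  case (snoc p a)
  show ?case
  proof (cases "park_car u (park u a) p = Some j")
    case True
    then show ?thesis
      by (auto simp: park_snoc park_car_eq_Some_iff)
  qed (use snoc in \<open>simp add: park_snoc\<close>)
qed simp

text \<open>The capacities add up to the number of cars, so no place stays empty once everybody has
  parked: the spots taken form a multiset contained in \<open>mset u\<close> and of the same size.\<close>

lemma spots_full: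
  assumes "a \<in> parking_functions u"
  shows "count_list (park u a) (Some j) = count_list u j"
proof -
  define t where "t = map the (park u a)"
  have "None \<notin> set (park u a)"
    using assms by (simp add: parking_functions_def)
  then have park_a: "park u a = map Some t"
    unfolding t_def by (metis (mono_tags, lifting) list.map_comp map_idI comp_apply option.collapse)
  have count_t: "count_list (park u a) (Some i) = count_list t i" for i
    unfolding park_a by (induction t) auto
  have "mset t \<subseteq># mset u"
    using count_park_le_capacity[of u a]
    by (simp add: subseteq_mset_def count_mset count_t)
  moreover have "size (mset t) = size (mset u)"
    using assms by (simp add: t_def parking_functions_def)
  ultimately have "mset t = mset u"
    by (metis less_irrefl mset_subset_size subset_mset.le_neq_trans)
  then show ?thesis
    by (metis count_mset count_t)
qed

lemma parks_somewhere:
  assumes "a \<in> parking_functions u" and "k < length a"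
  obtains i where "park u a ! k = Some i"
  using assms by (metis (no_types, lifting) length_park mem_Collect_eq not_None_eq
      nth_mem parking_functions_def)

lemma park_spot_bounds:
  assumes "park u a ! k = Some i" and "k < length a"
  shows "a ! k \<le> i" and "i \<in> set u"
proof -
  have "a ! k \<le> i" "count_list u i \<noteq> 0"
    using assms by (auto simp: park_nth park_car_eq_Some_iff)
  then show "a ! k \<le> i" "i \<in> set u"
    by (auto simp: count_list_0_iff)
qed

section \<open>Lucky cars\<close>

lemma unlucky_car_follows_previous_spot:
  assumes "park u a ! k = Some (Suc i)" and "k < length a" and "a ! k \<noteq> Suc i"
    and "park u a ! m = Some i" and "m < length a"
  shows "m < k"
proof (rule ccontr)
  assume "\<not> m < k"
  have "a ! k \<le> i"
    using park_spot_bounds(1)[OF assms(1,2)] assms(3) by simp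
  then have "count_list u i \<le> count_list (take k (park u a)) (Some i)"
    using assms(1,2) by (simp add: park_nth park_car_eq_Some_iff)
  also have "\<dots> < count_list (park u a) (Some i)"
    unfolding count_list_take_less_iff using \<open>\<not> m < k\<close> assms(4,5)
    by (intro exI[of _ m]) simp
  also have "\<dots> \<le> count_list u i"
    by (rule count_park_le_capacity)
  finally show False
    by simp
qed

text \<open>The converse: shifting the preference of a car outside \<open>I\<close> to the previous spot, which is
  full by the time the car enters, changes neither its parking spot nor that of any other car.\<close>

lemma park_with_lucky_set:
  assumes a: "a \<in> parking_functions u" and pos: "\<forall>x\<in>set u. 1 \<le> x"
    and I: "I \<subseteq> {1..length a}"
    and first: "\<And>k. k < length a \<Longrightarrow> park u a ! k = Some 1 \<Longrightarrow> Suc k \<in> I"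
    and descent: "\<And>k m i. k < m \<Longrightarrow> m < length a \<Longrightarrow> park u a ! k = Some (Suc i) \<Longrightarrow>
      park u a ! m = Some i \<Longrightarrow> Suc k \<in> I"
  obtains a' where "a' \<in> parking_functions u" "park u a' = park u a" "lucky u a' = I"
proof -
  define spot where "spot k = the (park u a ! k)" for k
  define a' where
    "a' = map (\<lambda>k. if Suc k \<in> I then spot k else spot k - 1) [0..<length a]"
  have len: "length a' = length a"
    by (simp add: a'_def)
  have spot: "park u a ! k = Some (spot k)" if "k < length a" for k
    by (rule parks_somewhere[OF a that]) (simp add: spot_def)
  have spot_pos: "1 \<le> spot k" if "k < length a" for k
    using park_spot_bounds(2)[OF spot[OF that] that] pos by blast
  have nth_a': "a' ! k = (if Suc k \<in> I then spot k else spot k - 1)" if "k < length a" for k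
    using that by (simp add: a'_def)
  have park_a': "park u a' = park u a"
  proof (rule park_eqI)
    fix k
    assume "k < length a'"
    then have k: "k < length a"
      by (simp add: len)
    let ?s = "take k (park u a)"
    have room: "count_list ?s (Some (spot k)) < count_list u (spot k)"
      using spot[OF k] k by (simp add: park_nth park_car_eq_Some_iff)
    have full: "count_list u i \<le> count_list ?s (Some i)" if "a' ! k \<le> i" "i < spot k" for i
    proof -
      \<comment> \<open>Only a car outside \<open>I\<close> passes a spot, and only the one before its own.\<close>
      have k_notin: "Suc k \<notin> I" and i: "spot k = Suc i"
        using that nth_a'[OF k] by (auto split: if_splits)
      have "\<not> (\<exists>m. k \<le> m \<and> m < length a \<and> park u a ! m = Some i)"
      proof
        assume "\<exists>m. k \<le> m \<and> m < length a \<and> park u a ! m = Some i"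
        then obtain m where m: "k \<le> m" "m < length a" "park u a ! m = Some i"
          by blast
        then have "k < m"
          using spot[OF k] i by (cases "k = m") auto
        then show False
          using descent m(2,3) spot[OF k] i k_notin by auto
      qed
      then have "\<not> count_list ?s (Some i) < count_list (park u a) (Some i)"
        by (simp add: count_list_take_less_iff)
      then show ?thesis
        by (simp add: spots_full[OF a])
    qed
    have "a' ! k \<le> spot k"
      using nth_a'[OF k] by simp
    with room full have "park_car u ?s (a' ! k) = Some (spot k)"
      by (simp add: park_car_eq_Some_iff)
    then show "park u a ! k = park_car u ?s (a' ! k)"
      using spot[OF k] by simp
  qed (simp add: len)
  have "1 \<le> a' ! k" if k: "k < length a" for k
  proof (cases "Suc k \<in> I")
    case False
    \<comment> \<open>Spot 1 has no predecessor to prefer; this is where the condition on it enters.\<close>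
    then have "spot k \<noteq> 1"
      using first[OF k] spot[OF k] by auto
    then show ?thesis
      using spot_pos[OF k] nth_a'[OF k] False by auto
  qed (use spot_pos[OF k] nth_a'[OF k] in auto)
  then have "a' \<in> parking_functions u"
    using a park_a' by (auto simp: parking_functions_def len in_set_conv_nth)
  moreover have "lucky u a' = I"
  proof (rule set_eqI)
    fix c
    show "c \<in> lucky u a' \<longleftrightarrow> c \<in> I"
    proof (cases "c \<in> {1..length a}")
      case True
      then have k: "c - 1 < length a" and c: "Suc (c - 1) = c"
        by auto
      have "c \<in> lucky u a' \<longleftrightarrow> spot (c - 1) = a' ! (c - 1)"
        using True spot[OF k] by (simp add: lucky_def len park_a')
      also have "\<dots> \<longleftrightarrow> c \<in> I"
        using nth_a'[OF k] spot_pos[OF k] unfolding c by auto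
      finally show ?thesis .
    next
      case False
      then show ?thesis
        using I by (auto simp: lucky_def len)
    qed
  qed
  ultimately show thesis
    using that park_a' by blast
qed

section \<open>Outcomes\<close>

lemma nth_block_outcome:
  assumes "1 \<le> i" and "i \<le> Max (set u)"
  shows "nth_block (outcome u a) i =
    (if count_list u i > 0
     then Cars {c \<in> {1..length a}. park u a ! (c - 1) = Some i} else Unavailable)"
  using assms by (simp add: nth_block_def outcome_def del: upt_Suc)

lemma cars_nth_block_outcome:
  assumes "1 \<le> i" and "i \<le> Max (set u)"
  shows "c \<in> cars (nth_block (outcome u a) i) \<longleftrightarrow>
    c \<in> {1..length a} \<and> park u a ! (c - 1) = Some i"
proof -
  have "i \<in> set u" if "c \<in> {1..length a}" "park u a ! (c - 1) = Some i"
    using park_spot_bounds(2)[OF that(2)] that(1) by auto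
  then show ?thesis
    using assms by (auto simp: nth_block_outcome count_list_0_iff)
qed

lemma nonempty_block_available: "c \<in> cars b \<Longrightarrow> b \<noteq> Unavailable"
  by auto

theorem theorem3p7:
  fixes u :: "nat list" and I :: "nat set" and B :: "block list"
  assumes "u \<noteq> []" and "sorted u" and "\<forall>x\<in>set u. 1 \<le> x"
    and "I \<subseteq> {1..length u}"
    and "B \<in> outcomes u"
  shows "B \<in> lucky_outcomes u I \<longleftrightarrow>
    (nth_block B 1 \<noteq> Unavailable \<longrightarrow> cars (nth_block B 1) \<subseteq> I) \<and>
    (\<forall>i\<in>{2..Max (set u)}. \<forall>b1 b2.
      nth_block B (i - 1) \<noteq> Unavailable \<and> b1 \<in> cars (nth_block B (i - 1)) \<and>
      nth_block B i \<noteq> Unavailable \<and> b2 \<in> cars (nth_block B i) \<and> b1 > b2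
      \<longrightarrow> b2 \<in> I)"
    (is "_ \<longleftrightarrow> ?first \<and> ?descent")
proof
  have M: "1 \<le> Max (set u)"
    using assms(1,3) by simp
  {
    assume "B \<in> lucky_outcomes u I"
    then obtain a where a: "a \<in> parking_functions u" and B: "B = outcome u a"
      and I: "lucky u a = I"
      by (auto simp: lucky_outcomes_def)
    have pref_pos: "1 \<le> a ! k" if "k < length a" for k
      using a that by (auto simp: parking_functions_def)
    have ?first
    proof (intro impI subsetI)
      fix c
      assume "c \<in> cars (nth_block B 1)"
      then have c: "c \<in> {1..length a}" "park u a ! (c - 1) = Some 1"
        using M by (auto simp: B cars_nth_block_outcome)
      then have k: "c - 1 < length a"
        by auto
      have "a ! (c - 1) = 1"
        using park_spot_bounds(1)[OF c(2) k] pref_pos[OF k] by simp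
      with c show "c \<in> I"
        by (simp add: I[symmetric] lucky_def)
    qed
    moreover have ?descent
    proof (intro ballI allI impI, elim conjE)
      fix i b1 b2
      assume i: "i \<in> {2..Max (set u)}" and less: "b2 < b1"
        and b1: "b1 \<in> cars (nth_block B (i - 1))" and b2: "b2 \<in> cars (nth_block B i)"
      from i have "Suc (i - 1) = i" "1 \<le> i - 1" "i - 1 \<le> Max (set u)"
        "1 \<le> i" "i \<le> Max (set u)"
        by auto
      then have b1: "b1 \<in> {1..length a}" "park u a ! (b1 - 1) = Some (i - 1)"
        and b2: "b2 \<in> {1..length a}" "park u a ! (b2 - 1) = Some (Suc (i - 1))"
        using b1 b2 by (simp_all add: B cars_nth_block_outcome)
      have "a ! (b2 - 1) = Suc (i - 1)"
      proof (rule ccontr)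
        assume "a ! (b2 - 1) \<noteq> Suc (i - 1)"
        then have "b1 - 1 < b2 - 1"
          using unlucky_car_follows_previous_spot[OF b2(2) _ _ b1(2)] b1(1) b2(1) by auto
        with less show False
          by simp
      qed
      with b2 show "b2 \<in> I"
        by (simp add: I[symmetric] lucky_def)
    qed
    ultimately show "?first \<and> ?descent"
      by blast
  }
  {
    assume conds: "?first \<and> ?descent"
    from assms(5) obtain a where a: "a \<in> parking_functions u" and B: "B = outcome u a"
      by (auto simp: outcomes_def)
    have len: "length a = length u"
      using a by (simp add: parking_functions_def)
    have in_block: "Suc k \<in> cars (nth_block B i)" "1 \<le> i" "i \<le> Max (set u)"
      if "k < length a" "park u a ! k = Some i" for k i
    proof -
      have "i \<in> set u"
        using park_spot_bounds(2) that by blast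
      then show i: "1 \<le> i" "i \<le> Max (set u)"
        using assms(3) by auto
      show "Suc k \<in> cars (nth_block B i)"
        using that by (simp add: B cars_nth_block_outcome[OF i])
    qed
    have first: "Suc k \<in> I" if "k < length a" "park u a ! k = Some 1" for k
      using conds in_block(1)[OF that] nonempty_block_available by blast
    have descent: "Suc k \<in> I" if "k < m" "m < length a"
      "park u a ! k = Some (Suc i)" "park u a ! m = Some i" for k m i
    proof -
      have k: "k < length a"
        using that by simp
      have "Suc i \<in> {2..Max (set u)}"
        using in_block(3)[OF k that(3)] in_block(2)[OF that(2,4)] by simp
      moreover have "Suc m \<in> cars (nth_block B (Suc i - 1))" "Suc k \<in> cars (nth_block B (Suc i))"
        using in_block(1)[OF k that(3)] in_block(1)[OF that(2,4)] by simp_all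
      moreover have "Suc k < Suc m"
        using that by simp
      ultimately show ?thesis
        using conds nonempty_block_available by blast
    qed
    have "I \<subseteq> {1..length a}"
      using assms(4) len by simp
    then obtain a' where a': "a' \<in> parking_functions u" "park u a' = park u a" "lucky u a' = I"
      by (rule park_with_lucky_set[OF a assms(3) _ first descent])
    have "length a' = length a"
      using a' len by (simp add: parking_functions_def)
    then have "outcome u a' = B"
      by (simp add: B outcome_def a'(2))
    with a' show "B \<in> lucky_outcomes u I"
      by (auto simp: lucky_outcomes_def)
  }
qed

end
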